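(* Let $\mathcal{P}$ be a homogeneous Poisson process on $\mathbb{R}^3$ of intensity $1$, and let $d$ denote either the Euclidean metric or the metric induced by the norm $\|(x_1,x_2,t)\|_{JM}=\sqrt{x_1^2+x_2^2}+|t|$. Let $O$ be the origin. For $A>0$ and $k\ge1$ let $E_k=E_{k,A}$ be the event that $\mathcal{P}$ contains $k$ points $P_1,\dots,P_k$ for which there exist points $Q_1,\dots,Q_k\in\mathbb{R}^3$ and real numbers $0<r_1,\dots,r_k<Ak^{1/3}$ such that $d(O,Q_i)=d(P_i,Q_i)=r_i$ for every $i$, and $d(P_j,Q_i)\ge r_i$ for all $i$ and $j$. If $A>0$ and $C>0$ are constants, then $\mathbb{P}(E_k)=o(e^{-Ck})$ as $k\to\infty$. *)

theory Defs
  imports "HOL-Probability.Probability" "HOL-Library.Landau_Symbols"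
begin

definition dist_JM :: "real^3 \<Rightarrow> real^3 \<Rightarrow> real" where
  "dist_JM x y = sqrt ((x$1 - y$1)^2 + (x$2 - y$2)^2) + \<bar>x$3 - y$3\<bar>"

definition poisson_process_R3 :: "'w measure \<Rightarrow> ('w \<Rightarrow> (real^3) set) \<Rightarrow> bool" where
  "poisson_process_R3 M N \<longleftrightarrow>
     prob_space M \<and>
     (\<forall>\<omega>\<in>space M. \<forall>B. bounded B \<longrightarrow> finite (N \<omega> \<inter> B)) \<and>
     (\<forall>B. B \<in> sets lborel \<and> bounded B \<longrightarrow>
        (\<lambda>\<omega>. card (N \<omega> \<inter> B)) \<in> measurable M (count_space UNIV) \<and>
        (\<forall>n::nat. measure M {\<omega>\<in>space M. card (N \<omega> \<inter> B) = n}
            = exp (- measure lborel B) * (measure lborel B) ^ n / fact n)) \<and>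
     (\<forall>(Bs :: nat \<Rightarrow> (real^3) set) I. finite I \<and> disjoint_family_on Bs I \<and>
        (\<forall>i\<in>I. Bs i \<in> sets lborel \<and> bounded (Bs i)) \<longrightarrow>
        prob_space.indep_vars M (\<lambda>_. count_space UNIV) (\<lambda>i \<omega>. card (N \<omega> \<inter> Bs i)) I)"

text \<open>Outer probability (coincides with the probability on measurable events).\<close>
definition outer_prob :: "'w measure \<Rightarrow> 'w set \<Rightarrow> real" where
  "outer_prob M A = Inf {measure M B | B. B \<in> sets M \<and> A \<inter> space M \<subseteq> B}"

definition event_E :: "(real^3 \<Rightarrow> real^3 \<Rightarrow> real) \<Rightarrow> real \<Rightarrow> ('w \<Rightarrow> (real^3) set) \<Rightarrow> nat \<Rightarrow> 'w set" where
  "event_E d A N k = {\<omega>. \<exists>P :: nat \<Rightarrow> real^3. inj_on P {1..k} \<and> (\<forall>i\<in>{1..k}. P i \<in> N \<omega>) \<and>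
      (\<exists>(Q :: nat \<Rightarrow> real^3) (r :: nat \<Rightarrow> real).
         (\<forall>i\<in>{1..k}. 0 < r i \<and> r i < A * real k powr (1/3) \<and>
              d 0 (Q i) = r i \<and> d (P i) (Q i) = r i) \<and>
         (\<forall>i\<in>{1..k}. \<forall>j\<in>{1..k}. d (P j) (Q i) \<ge> r i))}"

end

theory Submission
  imports Defs
begin

text \<open>
  Rescale by \<open>k\<close> to the power \<open>1/3\<close>. No \<open>P\<^sub>j\<close> lies in the open ball of radius \<open>r\<^sub>i\<close> about \<open>Q\<^sub>i\<close>, while
  \<open>P\<^sub>i\<close> lies on its boundary; so, apart from the points with \<open>r\<^sub>i < h\<close>, which lie within distance
  \<open>2h\<close> of \<open>O\<close>, the points form a set that is porous at every scale up to \<open>h\<close>: of the \<open>9\<^sup>3 = 729\<close>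
  subcubes of any small cube at least one is free of points. After \<open>p\<close> subdivisions the points
  occupy cells whose volume is only a fraction \<open>(728/729)\<^sup>p\<close> of the whole. Hence for every \<open>v > 0\<close> the
  \<open>k\<close> points lie in one of a number, independent of \<open>k\<close>, of sets of volume at most \<open>v k\<close>, and for
  each of these the Poisson tail bound gives probability at most \<open>(e v)\<close> to the power \<open>k\<close>.
\<close>

section \<open>Cubic grids and their ninefold refinement\<close>

definition cell :: "real \<Rightarrow> real^3 \<Rightarrow> int \<times> int \<times> int" where
  "cell s x = (\<lfloor>x$1 / s\<rfloor>, \<lfloor>x$2 / s\<rfloor>, \<lfloor>x$3 / s\<rfloor>)"

text \<open>Closed cubes, although the sets of constant \<open>cell\<close> are half-open: they
  serve only as a cover of known volume, so shared faces do no harm.\<close>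

definition cell_box :: "real \<Rightarrow> int \<times> int \<times> int \<Rightarrow> (real^3) set" where
  "cell_box s = (\<lambda>(a, b, c).
     (let v = s *\<^sub>R vector [of_int a, of_int b, of_int c] in cbox v (v + (\<chi> i. s))))"

definition subcells :: "int \<times> int \<times> int \<Rightarrow> (int \<times> int \<times> int) set" where
  "subcells = (\<lambda>(a, b, c). {9*a..9*a+8} \<times> {9*b..9*b+8} \<times> {9*c..9*c+8})"

definition index_cube :: "int \<Rightarrow> (int \<times> int \<times> int) set" where
  "index_cube J = {-J..J} \<times> {-J..J} \<times> {-J..J}"

lemma finite_index_cube: "finite (index_cube J)"
  by (simp add: index_cube_def)

lemma card_subcells: "card (subcells c) = 729"
  by (cases c) (simp add: subcells_def card_cartesian_product)

lemma finite_subcells: "finite (subcells c)"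
  by (cases c) (simp add: subcells_def)

lemma floor_ninth:
  fixes y s :: real
  shows "9 * \<lfloor>y / s\<rfloor> \<le> \<lfloor>y / (s / 9)\<rfloor>" "\<lfloor>y / (s / 9)\<rfloor> \<le> 9 * \<lfloor>y / s\<rfloor> + 8"
proof -
  have "y / (s / 9) = 9 * (y / s)" by simp
  moreover have "9 * \<lfloor>z\<rfloor> \<le> \<lfloor>9 * z\<rfloor>" "\<lfloor>9 * z\<rfloor> \<le> 9 * \<lfloor>z\<rfloor> + 8" for z :: real
    by linarith+
  ultimately show "9 * \<lfloor>y / s\<rfloor> \<le> \<lfloor>y / (s / 9)\<rfloor>" "\<lfloor>y / (s / 9)\<rfloor> \<le> 9 * \<lfloor>y / s\<rfloor> + 8"
    by presburger+
qed

lemma cell_ninth_in_subcells: "cell (s / 9) x \<in> subcells (cell s x)"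
  using floor_ninth by (simp add: cell_def subcells_def del: divide_divide_eq_right)

lemma mem_cell_box:
  assumes "s > 0"
  shows "x \<in> cell_box s (cell s x)"
proof -
  have "s * of_int \<lfloor>y / s\<rfloor> \<le> y \<and> y \<le> s * of_int \<lfloor>y / s\<rfloor> + s" for y
  proof -
    have "of_int \<lfloor>y / s\<rfloor> \<le> y / s" "y / s \<le> of_int \<lfloor>y / s\<rfloor> + 1" by linarith+
    then show ?thesis
      using assms mult_left_mono[of "of_int \<lfloor>y / s\<rfloor>" "y / s" s]
        mult_left_mono[of "y / s" "of_int \<lfloor>y / s\<rfloor> + 1" s]
      by (simp add: distrib_left)
  qed
  then show ?thesis
    by (simp add: cell_box_def cell_def Let_def mem_box_cart forall_3)
qed

lemma measure_cube:
  assumes "w \<ge> 0"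
  shows "measure lborel (cbox v (v + (\<chi> i::3. w))) = w ^ 3"
proof -
  have "v \<in> cbox v (v + (\<chi> i::3. w))" using assms by (simp add: mem_box_cart)
  then have "cbox v (v + (\<chi> i::3. w)) \<noteq> {}" by blast
  then show ?thesis by (simp add: content_cbox_cart)
qed

lemma measure_cell_box: "s \<ge> 0 \<Longrightarrow> measure lborel (cell_box s c) = s ^ 3"
  by (cases c) (simp add: cell_box_def Let_def measure_cube)

lemma sets_cell_box: "cell_box s c \<in> sets lborel"
  by (cases c) (simp add: cell_box_def Let_def)

lemma bounded_cell_box: "bounded (cell_box s c)"
  by (cases c) (simp add: cell_box_def Let_def)

section \<open>Porosity with respect to a norm\<close>

text \<open>The last two axioms place \<open>n\<close> between the maximum norm and the l1 norm.
  That is all that is needed to compare \<open>n\<close> with cubes, so one argument serves both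
  metrics.\<close>

locale coordinate_norm =
  fixes n :: "real^3 \<Rightarrow> real"
  assumes scale: "n (t *\<^sub>R v) = \<bar>t\<bar> * n v"
    and triangle: "n (u + v) \<le> n u + n v"
    and component_le: "\<bar>v $ i\<bar> \<le> n v"
    and le_sum: "n v \<le> \<bar>v$1\<bar> + \<bar>v$2\<bar> + \<bar>v$3\<bar>"
begin

lemma minus: "n (- v) = n v"
  using scale[of "-1" v] by simp

lemma n_eq_cell:
  assumes "s > 0" "cell s x = cell s y"
  shows "n (x - y) < 3 * s"
proof -
  have *: "\<bar>u - v\<bar> < s" if "\<lfloor>u / s\<rfloor> = \<lfloor>v / s\<rfloor>" for u v
  proof -
    have "\<bar>u / s - v / s\<bar> < 1" using that by linarith
    then show ?thesis using assms(1) by (simp add: abs_less_iff field_simps)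
  qed
  have "\<bar>x$1 - y$1\<bar> < s" "\<bar>x$2 - y$2\<bar> < s" "\<bar>x$3 - y$3\<bar> < s"
    using assms(2) * by (simp_all add: cell_def)
  then show ?thesis using le_sum[of "x - y"] by simp
qed

text \<open>If the central subcell contains some \<open>P\<close>, the ball of \<open>P\<close> contains a ball of radius \<open>s/3\<close> that
  also touches \<open>P\<close>; the subcell of its centre \<open>Z\<close> lies inside both that ball and the cell \<open>c\<close>.\<close>

lemma exists_free_subcell:
  assumes s: "s > 0"
    and S: "\<And>P. P \<in> S \<Longrightarrow> \<exists>Q r. s / 3 \<le> r \<and> n (P - Q) = r \<and> (\<forall>P'\<in>S. r \<le> n (P' - Q))"
  shows "\<exists>u\<in>subcells c. u \<notin> cell (s / 9) ` S"
proof -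
  obtain c1 c2 c3 where c: "c = (c1, c2, c3)" by (cases c)
  let ?m = "(9*c1+4, 9*c2+4, 9*c3+4)"
  show ?thesis
  proof (cases "?m \<in> cell (s / 9) ` S")
    case False
    then show ?thesis by (intro bexI[of _ ?m]) (simp_all add: c subcells_def)
  next
    case True
    then obtain P where P: "P \<in> S" "cell (s / 9) P = ?m" by force
    then obtain Q r where Q: "s / 3 \<le> r" "n (P - Q) = r" "\<forall>P'\<in>S. r \<le> n (P' - Q)"
      using S by blast
    \<comment> \<open>\<open>Z\<close> is the point of the segment from \<open>P\<close> to
      \<open>Q\<close> at distance \<open>s / 3\<close> from \<open>P\<close>;
      \<open>s / 3 \<le> r\<close> keeps it between them.\<close>
    define t where "t = (s / 3) / r"
    define Z where "Z = P + t *\<^sub>R (Q - P)"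
    have r: "r > 0" using Q s by linarith
    have t: "0 \<le> t" "t \<le> 1" "t * r = s / 3" using Q r s by (simp_all add: t_def)
    have nQP: "n (Q - P) = r" using minus[of "P - Q"] Q by simp
    have "n (Z - P) = s / 3" using t by (simp add: Z_def scale nQP)
    then have near: "\<bar>Z$i - P$i\<bar> \<le> s / 3" for i
      using component_le[of "Z - P" i] by simp
    have "Z - Q = (1 - t) *\<^sub>R (P - Q)" by (simp add: Z_def algebra_simps)
    then have ZQ: "n (Z - Q) = r - s / 3"
      using t by (simp add: scale Q left_diff_distrib)
    \<comment> \<open>A distance of \<open>s / 3\<close> is three subcell sides, so each index moves
      by at most 3 from the central value and stays inside the block of nine.\<close>
    have sub: "\<lfloor>Z$i / (s / 9)\<rfloor> \<in> {9*a..9*a+8}" if "\<lfloor>P$i / (s / 9)\<rfloor> = 9*a+4" for i a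
    proof -
      have "\<bar>Z$i / (s / 9) - P$i / (s / 9)\<bar> \<le> 3"
        using abs_le_D1[OF near[of i]] abs_le_D2[OF near[of i]] s
        by (simp add: abs_le_iff field_simps)
      then show ?thesis using that unfolding atLeastAtMost_iff by linarith
    qed
    have "cell (s / 9) Z \<in> subcells c"
      using P(2) sub by (simp add: c cell_def subcells_def del: divide_divide_eq_right)
    moreover have "cell (s / 9) Z \<notin> cell (s / 9) ` S"
    proof
      assume "cell (s / 9) Z \<in> cell (s / 9) ` S"
      then obtain P' where P': "P' \<in> S" "cell (s / 9) P' = cell (s / 9) Z" by force
      \<comment> \<open>A subcell has side \<open>s / 9\<close>, so \<open>n_eq_cell\<close> gives
        the strict bound \<open>3 * (s / 9)\<close>; strictness puts \<open>P'\<close> into the open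
        ball about \<open>Q\<close>.\<close>
      then have "n (P' - Z) < s / 3" using n_eq_cell[of "s / 9" P' Z] s by simp
      then have "n (P' - Q) < r"
        using triangle[of "P' - Z" "Z - Q"] ZQ by simp
      then show False using Q P' by force
    qed
    ultimately show ?thesis by blast
  qed
qed

text \<open>Every occupied subcell lies in an occupied cell, and each of these has a free subcell
  \<open>u c\<close>, leaving at most 728.\<close>

lemma card_cells_ninth:
  assumes s: "s > 0" and fin: "finite S"
    and S: "\<And>P. P \<in> S \<Longrightarrow> \<exists>Q r. s / 3 \<le> r \<and> n (P - Q) = r \<and> (\<forall>P'\<in>S. r \<le> n (P' - Q))"
  shows "card (cell (s / 9) ` S) \<le> 728 * card (cell s ` S)"
proof -
  obtain u where u: "\<And>c. u c \<in> subcells c" "\<And>c. u c \<notin> cell (s / 9) ` S"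
    using exists_free_subcell[OF s S] by metis
  have "cell (s / 9) ` S \<subseteq> (\<Union>c\<in>cell s ` S. subcells c - {u c})"
  proof (intro image_subsetI)
    fix x assume x: "x \<in> S"
    then have "cell (s / 9) x \<noteq> u (cell s x)" using u(2) by (metis imageI)
    then show "cell (s / 9) x \<in> (\<Union>c\<in>cell s ` S. subcells c - {u c})"
      using x cell_ninth_in_subcells[of s x] by blast
  qed
  then have "card (cell (s / 9) ` S) \<le> card (\<Union>c\<in>cell s ` S. subcells c - {u c})"
    by (intro card_mono) (auto simp: fin finite_subcells)
  also have "\<dots> \<le> (\<Sum>c\<in>cell s ` S. card (subcells c - {u c}))"
    by (intro card_UN_le) (simp add: fin)
  also have "\<dots> = 728 * card (cell s ` S)"
    by (simp add: u card_subcells finite_subcells)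
  finally show ?thesis .
qed

lemma card_cells_power:
  assumes s: "s > 0" and fin: "finite S"
    and S: "\<And>P. P \<in> S \<Longrightarrow> \<exists>Q r. s / 3 \<le> r \<and> n (P - Q) = r \<and> (\<forall>P'\<in>S. r \<le> n (P' - Q))"
  shows "card (cell (s / 9 ^ p) ` S) \<le> 728 ^ p * card (cell s ` S)"
proof (induction p)
  case (Suc p)
  \<comment> \<open>The radius condition at the coarsest scale implies it at all finer ones, so the
    same hypothesis drives every subdivision.\<close>
  have le: "s / 9 ^ p / 3 \<le> s / 3" using s by (simp add: field_simps)
  have "card (cell (s / 9 ^ p / 9) ` S) \<le> 728 * card (cell (s / 9 ^ p) ` S)"
    using s fin
  proof (intro card_cells_ninth)
    show "\<exists>Q r. s / 9 ^ p / 3 \<le> r \<and> n (P - Q) = r \<and> (\<forall>P'\<in>S. r \<le> n (P' - Q))" if "P \<in> S" for P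
      using S[OF that] le order_trans by blast
  qed auto
  also have "\<dots> \<le> 728 * (728 ^ p * card (cell s ` S))" using Suc by simp
  finally show ?case by (simp add: mult.commute)
qed simp

end

section \<open>Covering the points by a set of small volume\<close>

lemma cell_mem_index_cube:
  assumes s: "s > 0" and x: "\<And>i. \<bar>x$i\<bar> \<le> of_int J * s"
  shows "cell s x \<in> index_cube J"
proof -
  have "\<lfloor>x$i / s\<rfloor> \<in> {-J..J}" for i
  proof -
    have "\<bar>x$i / s\<bar> \<le> of_int J" using x[of i] s by (simp add: abs_le_iff field_simps)
    then show ?thesis unfolding atLeastAtMost_iff by linarith
  qed
  then show ?thesis by (simp add: cell_def index_cube_def)
qed

lemma card_index_cube: "J \<ge> 0 \<Longrightarrow> card (index_cube J) = nat (2 * J + 1) ^ 3"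
  by (simp add: index_cube_def card_cartesian_product power3_eq_cube)

text \<open>The central cube takes the points with \<open>r i < h\<close>, the small cells the
  others. The initial side \<open>3 * h\<close> is the largest one for which
  \<open>h \<le> r i\<close> gives the radius condition of \<open>card_cells_power\<close>.\<close>

definition region :: "real \<Rightarrow> nat \<Rightarrow> (int \<times> int \<times> int) set \<Rightarrow> (real^3) set" where
  "region h p F = cbox (\<chi> i. - 2 * h) ((\<chi> i. - 2 * h) + (\<chi> i. 4 * h)) \<union>
     (\<Union>c\<in>F. cell_box (3 * h / 9 ^ p) c)"

lemma sets_region: "finite F \<Longrightarrow> region h p F \<in> sets lborel"
  unfolding region_def using sets_cell_box
  by (intro sets.Un sets.finite_UN) auto

lemma bounded_region: "finite F \<Longrightarrow> bounded (region h p F)"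
  unfolding region_def using bounded_cell_box by (intro bounded_Un[THEN iffD2]) auto

lemma measure_region_le:
  assumes "finite F" "h \<ge> 0"
  shows "measure lborel (region h p F) \<le> 64 * h ^ 3 + real (card F) * (27 * h ^ 3 / 729 ^ p)"
proof -
  have [simp]: "(9 ^ p) ^ 3 = (729::real) ^ p"
    by (simp flip: power_mult add: mult.commute[of p]) (simp add: power_mult)
  have "measure lborel (region h p F) \<le>
      measure lborel (cbox (\<chi> i. - 2 * h) ((\<chi> i. - 2 * h) + (\<chi> i::3. 4 * h))) +
      measure lborel (\<Union>c\<in>F. cell_box (3 * h / 9 ^ p) c)"
    unfolding region_def using assms sets_cell_box
    by (intro measure_Un_le sets.finite_UN) auto
  also have "\<dots> \<le> (4 * h) ^ 3 + (\<Sum>c\<in>F. measure lborel (cell_box (3 * h / 9 ^ p) c))"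
    using assms sets_cell_box measure_cube[of "4 * h" "\<chi> i. - 2 * h"]
    by (intro add_mono measure_UNION_le) auto
  also have "\<dots> = 64 * h ^ 3 + real (card F) * (27 * h ^ 3 / 729 ^ p)"
    using assms by (simp add: measure_cell_box power_mult_distrib power_divide)
  finally show ?thesis .
qed

text \<open>The set \<open>F\<close> depends on the points but ranges over subsets of a fixed finite
  index cube, which makes a union bound possible later.\<close>

lemma (in coordinate_norm) points_subset_region:
  fixes P Q :: "nat \<Rightarrow> real^3" and r :: "nat \<Rightarrow> real"
  assumes h: "h > 0" and J: "J \<ge> 0" "2 * R \<le> of_int J * (3 * h)" and I: "finite I"
    and r: "\<And>i. i \<in> I \<Longrightarrow> r i < R \<and> n (Q i) = r i \<and> n (P i - Q i) = r i"
    and empty: "\<And>i j. i \<in> I \<Longrightarrow> j \<in> I \<Longrightarrow> r i \<le> n (P j - Q i)"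
  shows "\<exists>F\<subseteq>index_cube (9 ^ p * J). card F \<le> 728 ^ p * nat (2 * J + 1) ^ 3 \<and> P ` I \<subseteq> region h p F"
proof -
  define S where "S = P ` {i\<in>I. h \<le> r i}"
  define F where "F = cell (3 * h / 9 ^ p) ` S"
  have fin: "finite S" using I by (simp add: S_def)
  \<comment> \<open>Both the origin and \<open>P i\<close> are at distance \<open>r i\<close> from
    \<open>Q i\<close>.\<close>
  have P_le: "\<bar>P i $ j\<bar> \<le> 2 * r i" if "i \<in> I" for i j
    using component_le[of "P i" j] triangle[of "P i - Q i" "Q i"] r[OF that] by simp
  have S_le: "\<bar>x $ j\<bar> \<le> of_int J * (3 * h)" if "x \<in> S" for x j
  proof -
    obtain i where "i \<in> I" "x = P i" using \<open>x \<in> S\<close> by (auto simp: S_def)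
    then have "\<bar>x $ j\<bar> \<le> 2 * r i" "r i < R" using P_le r by blast+
    then show ?thesis using J(2) by linarith
  qed
  have "F \<subseteq> index_cube (9 ^ p * J)"
    unfolding F_def using h S_le by (intro image_subsetI cell_mem_index_cube) auto
  moreover have "card F \<le> 728 ^ p * nat (2 * J + 1) ^ 3"
  proof -
    have "card F \<le> 728 ^ p * card (cell (3 * h) ` S)"
      unfolding F_def
    proof (intro card_cells_power fin)
      fix x assume "x \<in> S"
      then obtain i where "i \<in> I" "h \<le> r i" "x = P i" by (auto simp: S_def)
      then show "\<exists>Q r. 3 * h / 3 \<le> r \<and> n (x - Q) = r \<and> (\<forall>P'\<in>S. r \<le> n (P' - Q))"
        using r empty by (intro exI[of _ "Q i"] exI[of _ "r i"]) (auto simp: S_def)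
    qed (use h in auto)
    moreover have "card (cell (3 * h) ` S) \<le> card (index_cube J)"
      using h S_le by (intro card_mono finite_index_cube image_subsetI cell_mem_index_cube) auto
    ultimately show ?thesis using card_index_cube[OF J(1)]
      by (metis le_trans mult_le_mono2)
  qed
  moreover have "P i \<in> region h p F" if "i \<in> I" for i
  proof (cases "h \<le> r i")
    case True
    then have "P i \<in> S" using that by (simp add: S_def)
    then show ?thesis using mem_cell_box[of "3 * h / 9 ^ p" "P i"] h
      by (auto simp: region_def F_def)
  next
    case False
    then have "\<bar>P i $ j\<bar> \<le> 2 * h" for j using P_le[OF that, of j] by linarith
    then show ?thesis by (auto simp: region_def mem_box_cart abs_le_iff minus_le_iff)
  qed
  ultimately show ?thesis by blast
qed

section \<open>The two metrics\<close>

lemma coordinate_norm_norm: "coordinate_norm norm"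
proof
  show "norm v \<le> \<bar>v$1\<bar> + \<bar>v$2\<bar> + \<bar>v$3\<bar>" for v :: "real^3"
    using norm_le_l1_cart[of v] by (simp add: sum_3)
qed (auto simp: norm_triangle_ineq component_le_norm_cart)

lemma coordinate_norm_JM: "coordinate_norm (\<lambda>v. dist_JM v 0)"
proof
  fix t :: real and u v :: "real^3" and i :: 3
  have "sqrt ((t * v$1)^2 + (t * v$2)^2) = \<bar>t\<bar> * sqrt ((v$1)^2 + (v$2)^2)"
    by (simp add: power_mult_distrib real_sqrt_mult flip: distrib_left)
  then show "dist_JM (t *\<^sub>R v) 0 = \<bar>t\<bar> * dist_JM v 0"
    by (simp add: dist_JM_def abs_mult distrib_left)
  show "dist_JM (u + v) 0 \<le> dist_JM u 0 + dist_JM v 0"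
    using real_sqrt_sum_squares_triangle_ineq[of "u$1" "v$1" "u$2" "v$2"]
    by (simp add: dist_JM_def)
  show "\<bar>v $ i\<bar> \<le> dist_JM v 0"
  proof -
    have "\<bar>v$1\<bar> \<le> sqrt ((v$1)^2 + (v$2)^2)" "\<bar>v$2\<bar> \<le> sqrt ((v$1)^2 + (v$2)^2)"
      by (intro real_le_rsqrt; simp)+
    moreover have "dist_JM v 0 = sqrt ((v$1)^2 + (v$2)^2) + \<bar>v$3\<bar>"
      by (simp add: dist_JM_def)
    moreover have "0 \<le> sqrt ((v$1)^2 + (v$2)^2)" by simp
    ultimately have "\<bar>v$1\<bar> \<le> dist_JM v 0" "\<bar>v$2\<bar> \<le> dist_JM v 0" "\<bar>v$3\<bar> \<le> dist_JM v 0"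
      by linarith+
    then show ?thesis using exhaust_3[of i] by metis
  qed
  show "dist_JM v 0 \<le> \<bar>v$1\<bar> + \<bar>v$2\<bar> + \<bar>v$3\<bar>"
    using sqrt_sum_squares_le_sum_abs[of "v$1" "v$2"] by (simp add: dist_JM_def)
qed

lemma metric_from_coordinate_norm:
  assumes "d = dist \<or> d = dist_JM"
  obtains n where "coordinate_norm n" "\<And>x y. d x y = n (x - y)"
  using assms
proof
  assume "d = dist"
  then show ?thesis using that[OF coordinate_norm_norm] by (simp add: dist_norm)
next
  assume "d = dist_JM"
  then show ?thesis using that[OF coordinate_norm_JM] by (simp add: dist_JM_def)
qed

section \<open>Poisson tails\<close>

text \<open>A single term of the exponential series; at \<open>x = k\<close> it replaces Stirling's
  formula.\<close>

lemma power_div_fact_le_exp: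
  fixes x :: real
  assumes "x \<ge> 0"
  shows "x ^ k / fact k \<le> exp x"
proof -
  have s: "(\<lambda>n. x ^ n / fact n) sums exp x"
    using exp_converges[of x] by (simp add: field_simps)
  have "(\<Sum>n\<in>{k}. x ^ n / fact n) \<le> (\<Sum>n. x ^ n / fact n)"
    using assms s by (intro sum_le_suminf) (auto simp: sums_iff)
  then show ?thesis using s by (simp add: sums_iff)
qed

text \<open>By \<open>k! n! \<le> (k + n)!\<close> the mass at \<open>k + n\<close> is at most
  \<open>l ^ k / fact k\<close> times the mass at \<open>n\<close>, and the masses sum to 1.\<close>

lemma (in prob_space) poisson_tail_le:
  fixes X :: "'a \<Rightarrow> nat" and l :: real
  assumes X: "X \<in> measurable M (count_space UNIV)" and l: "l \<ge> 0"
    and pmf: "\<And>n. prob {\<omega>\<in>space M. X \<omega> = n} = exp (- l) * l ^ n / fact n"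
  shows "prob {\<omega>\<in>space M. k \<le> X \<omega>} \<le> l ^ k / fact k"
proof -
  let ?E = "\<lambda>n. {\<omega>\<in>space M. X \<omega> = k + n}"
  have "?E n \<in> events" for n using X by measurable
  then have "(\<lambda>n. prob (?E n)) sums prob (\<Union>n. ?E n)"
    by (intro finite_measure_UNION) (auto simp: disjoint_family_on_def)
  also have "(\<Union>n. ?E n) = {\<omega>\<in>space M. k \<le> X \<omega>}"
    by (auto simp: le_iff_add)
  finally have 1: "(\<lambda>n. exp (- l) * l ^ (k + n) / fact (k + n)) sums prob {\<omega>\<in>space M. k \<le> X \<omega>}"
    by (simp add: pmf)
  have "(\<lambda>n. l ^ k / fact k * exp (- l) * (l ^ n / fact n)) sums (l ^ k / fact k * exp (- l) * exp l)"
    using exp_converges[of l] by (intro sums_mult) (simp add: field_simps)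
  then have 2: "(\<lambda>n. l ^ k / fact k * exp (- l) * (l ^ n / fact n)) sums (l ^ k / fact k)"
    by (simp add: mult.assoc flip: exp_add)
  have "exp (- l) * l ^ (k + n) / fact (k + n) \<le> l ^ k / fact k * exp (- l) * (l ^ n / fact n)" for n
  proof -
    have "fact k * fact n \<le> (fact (k + n) :: nat)"
      by (intro dvd_imp_le fact_fact_dvd_fact) auto
    then have "fact k * fact n \<le> (fact (k + n) :: real)"
      by (metis of_nat_fact of_nat_le_iff of_nat_mult)
    then have "exp (- l) * l ^ (k + n) / fact (k + n) \<le> exp (- l) * l ^ (k + n) / (fact k * fact n)"
      using l by (intro divide_left_mono) auto
    then show ?thesis by (simp add: power_add mult_ac)
  qed
  then show ?thesis using sums_le[OF _ 1 2] by blast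
qed

lemma poisson_process_tail_le:
  assumes N: "poisson_process_R3 M N" and B: "B \<in> sets lborel" "bounded B"
    and v: "measure lborel B \<le> v * real k"
  shows "measure M {\<omega>\<in>space M. k \<le> card (N \<omega> \<inter> B)} \<le> (exp 1 * v) ^ k"
proof -
  interpret prob_space M using N by (simp add: poisson_process_R3_def)
  have "measure M {\<omega>\<in>space M. k \<le> card (N \<omega> \<inter> B)} \<le> measure lborel B ^ k / fact k"
    using N B by (intro poisson_tail_le) (auto simp: poisson_process_R3_def)
  also have "\<dots> \<le> (v * real k) ^ k / fact k"
    using v by (intro divide_right_mono power_mono) auto
  also have "\<dots> \<le> (exp 1 * v) ^ k"
  proof (cases "k = 0")
    case False
    \<comment> \<open>The sign of \<open>v\<close> follows from the volume bound because
      \<open>k\<close> is nonzero.\<close>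
    have "0 \<le> v * real k" using v measure_nonneg[of lborel B] by linarith
    then have "v \<ge> 0" using False by (simp add: zero_le_mult_iff)
    have "real k ^ k / fact k \<le> exp 1 ^ k"
      using power_div_fact_le_exp[of "real k" k] by (simp flip: exp_of_nat_mult)
    then have "v ^ k * (real k ^ k / fact k) \<le> v ^ k * exp 1 ^ k"
      using \<open>v \<ge> 0\<close> by (intro mult_left_mono) auto
    then show ?thesis by (simp add: power_mult_distrib mult_ac)
  qed simp
  finally show ?thesis .
qed

section \<open>Union bound over the possible regions\<close>

lemma outer_prob_nonneg: "0 \<le> outer_prob M E"
  unfolding outer_prob_def by (intro cInf_greatest) auto

lemma outer_prob_le: "B \<in> sets M \<Longrightarrow> E \<inter> space M \<subseteq> B \<Longrightarrow> outer_prob M E \<le> measure M B"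
  unfolding outer_prob_def by (intro cInf_lower bdd_belowI[of _ 0]) auto

text \<open>The event is covered by the measurable events \<open>T F\<close>. Scaling lengths by
  \<open>q\<close> changes the regions but not the index sets, so the number of these events is
  bounded independently of \<open>k\<close>.\<close>

lemma outer_prob_event_E_le:
  assumes N: "poisson_process_R3 M N" and d: "d = dist \<or> d = dist_JM"
    and h: "h > 0" and J: "J \<ge> 0" "2 * A \<le> of_int J * (3 * h)"
    and v: "64 * h ^ 3 + 27 * h ^ 3 * real (nat (2 * J + 1) ^ 3) * (728 / 729) ^ p \<le> v"
    and k: "k > 0"
  shows "outer_prob M (event_E d A N k) \<le> 2 ^ card (index_cube (9 ^ p * J)) * (exp 1 * v) ^ k"
proof -
  interpret prob_space M using N by (simp add: poisson_process_R3_def)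
  obtain n where n: "coordinate_norm n" and dn: "\<And>x y. d x y = n (x - y)"
    using metric_from_coordinate_norm[OF d] by blast
  interpret coordinate_norm n by fact
  define q where "q = real k powr (1/3)"
  have q: "q > 0" "q ^ 3 = real k"
    using k by (simp_all add: q_def powr_powr flip: powr_realpow)
  define G where "G = index_cube (9 ^ p * J)"
  define m where "m = 728 ^ p * nat (2 * J + 1) ^ 3"
  define Fs where "Fs = {F \<in> Pow G. card F \<le> m}"
  define T where "T F = {\<omega>\<in>space M. k \<le> card (N \<omega> \<inter> region (h * q) p F)}" for F
  have finG: "finite G" by (simp add: G_def finite_index_cube)
  have Fs: "finite Fs" "card Fs \<le> 2 ^ card G"
    using finG card_mono[of "Pow G" Fs] by (auto simp: Fs_def card_Pow)
  have finF: "finite F" if "F \<in> Fs" for F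
    using that finG finite_subset by (auto simp: Fs_def)
  have T_le: "prob (T F) \<le> (exp 1 * v) ^ k" if "F \<in> Fs" for F
  proof -
    have "measure lborel (region (h * q) p F) \<le>
        64 * (h * q) ^ 3 + real (card F) * (27 * (h * q) ^ 3 / 729 ^ p)"
      using h q finF[OF that] by (intro measure_region_le) auto
    also have "\<dots> \<le> 64 * (h * q) ^ 3 + real m * (27 * (h * q) ^ 3 / 729 ^ p)"
      using that h q by (intro add_left_mono mult_right_mono) (auto simp: Fs_def)
    \<comment> \<open>Here \<open>q ^ 3 = k\<close> makes the volume proportional to
      \<open>k\<close>, and the cell count against the cell volume leaves
      \<open>(728 / 729) ^ p\<close>.\<close>
    also have "\<dots> = (64 * h ^ 3 + 27 * h ^ 3 * real (nat (2 * J + 1) ^ 3) * (728 / 729) ^ p) * real k"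
      by (simp add: m_def power_mult_distrib q power_divide algebra_simps)
    also have "\<dots> \<le> v * real k" using v by (intro mult_right_mono) auto
    finally show ?thesis
      unfolding T_def using finF[OF that]
      by (intro poisson_process_tail_le[OF N] sets_region bounded_region)
  qed
  have T_sets: "T F \<in> events" if "F \<in> Fs" for F
  proof -
    have "(\<lambda>\<omega>. card (N \<omega> \<inter> region (h * q) p F)) \<in> measurable M (count_space UNIV)"
      using N sets_region[OF finF[OF that]] bounded_region[OF finF[OF that]]
      by (simp add: poisson_process_R3_def)
    then show ?thesis unfolding T_def by measurable
  qed
  have sub: "event_E d A N k \<inter> space M \<subseteq> (\<Union>F\<in>Fs. T F)"
  proof
    fix \<omega> assume \<omega>: "\<omega> \<in> event_E d A N k \<inter> space M"
    then obtain P Q r where P: "inj_on P {1..k}" "\<forall>i\<in>{1..k}. P i \<in> N \<omega>"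
      and r: "\<forall>i\<in>{1..k}. 0 < r i \<and> r i < A * q \<and> d 0 (Q i) = r i \<and> d (P i) (Q i) = r i"
      and e: "\<forall>i\<in>{1..k}. \<forall>j\<in>{1..k}. d (P j) (Q i) \<ge> r i"
      unfolding event_E_def q_def by blast
    have "\<exists>F\<subseteq>index_cube (9 ^ p * J). card F \<le> 728 ^ p * nat (2 * J + 1) ^ 3 \<and>
        P ` {1..k} \<subseteq> region (h * q) p F"
    proof (rule points_subset_region[where r = r and Q = Q and R = "A * q"])
      show "2 * (A * q) \<le> of_int J * (3 * (h * q))"
        using mult_right_mono[OF J(2), of q] q by (simp add: mult_ac)
      show "r i < A * q \<and> n (Q i) = r i \<and> n (P i - Q i) = r i" if "i \<in> {1..k}" for i
        using bspec[OF r that] minus[of "Q i"] by (simp add: dn)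
      show "r i \<le> n (P j - Q i)" if "i \<in> {1..k}" "j \<in> {1..k}" for i j
        using e that by (simp add: dn)
    qed (use h q J in auto)
    then obtain F where F: "F \<in> Fs" "P ` {1..k} \<subseteq> region (h * q) p F"
      by (auto simp: Fs_def G_def m_def)
    \<comment> \<open>Needed for monotonicity of \<open>card\<close>, which is 0 on infinite
      sets.\<close>
    have "finite (N \<omega> \<inter> region (h * q) p F)"
      using N \<omega> bounded_region[OF finF[OF F(1)]] by (auto simp: poisson_process_R3_def)
    then have "card (P ` {1..k}) \<le> card (N \<omega> \<inter> region (h * q) p F)"
      using F P by (intro card_mono) auto
    then have "\<omega> \<in> T F" using P \<omega> by (simp add: T_def card_image)
    then show "\<omega> \<in> (\<Union>F\<in>Fs. T F)" using F by blast
  qed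
  have "outer_prob M (event_E d A N k) \<le> prob (\<Union>F\<in>Fs. T F)"
    using Fs T_sets sub by (intro outer_prob_le) auto
  also have "\<dots> \<le> (\<Sum>F\<in>Fs. prob (T F))"
    using Fs T_sets by (intro measure_UNION_le) auto
  also have "\<dots> \<le> real (card Fs) * (exp 1 * v) ^ k"
    using T_le sum_bounded_above[of Fs "\<lambda>F. prob (T F)"] by simp
  also have "\<dots> \<le> 2 ^ card G * (exp 1 * v) ^ k"
  proof (intro mult_right_mono)
    show "real (card Fs) \<le> 2 ^ card G"
      using Fs(2) by (metis of_nat_le_iff of_nat_numeral of_nat_power)
    \<comment> \<open>Any member of \<open>Fs\<close> shows that the bound in \<open>T_le\<close> is
      nonnegative, as it dominates a probability.\<close>
    have "{} \<in> Fs" by (simp add: Fs_def)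
    then show "0 \<le> (exp 1 * v) ^ k" using T_le measure_nonneg order_trans by blast
  qed
  finally show ?thesis by (simp add: G_def)
qed

section \<open>Choice of constants and comparison of decay rates\<close>

theorem theorem4p1:
  fixes M :: "'w measure" and N :: "'w \<Rightarrow> (real^3) set"
    and d :: "real^3 \<Rightarrow> real^3 \<Rightarrow> real" and A C :: real
  assumes "poisson_process_R3 M N"
    and "d = dist \<or> d = dist_JM"
    and "A > 0" and "C > 0"
  shows "(\<lambda>k. outer_prob M (event_E d A N k)) \<in> o(\<lambda>k. exp (- C * real k))"
proof -
  \<comment> \<open>Chosen so that \<open>exp 1 * v = exp (- (C + 1))\<close>, one unit of decay
    more than required.\<close>
  define v where "v = exp (- (C + 2))"
  have v: "v > 0" by (simp add: v_def)
  \<comment> \<open>Half of the volume budget \<open>v\<close> goes to the central cube; the other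
    half is left for the small cells.\<close>
  define h where "h = root 3 (v / 128)"
  have h: "h > 0" "64 * h ^ 3 = v / 2" using v by (simp_all add: h_def)
  \<comment> \<open>\<open>J\<close> depends only on \<open>A\<close> and \<open>h\<close>, hence is
    fixed before \<open>p\<close> is sent to infinity.\<close>
  define J where "J = \<lceil>2 * A / (3 * h)\<rceil>"
  have J: "J \<ge> 0" "2 * A \<le> of_int J * (3 * h)"
  proof -
    have "2 * A / (3 * h) > 0" using assms(3) h by simp
    then show "J \<ge> 0" unfolding J_def by linarith
    have "2 * A / (3 * h) \<le> of_int J" unfolding J_def by linarith
    then show "2 * A \<le> of_int J * (3 * h)" using h by (simp add: field_simps)
  qed
  have "(\<lambda>p. 27 * h ^ 3 * real (nat (2 * J + 1) ^ 3) * (728 / 729) ^ p) \<longlonglongrightarrow>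
      27 * h ^ 3 * real (nat (2 * J + 1) ^ 3) * 0"
    by (intro tendsto_intros LIMSEQ_power_zero) auto
  then have "\<forall>\<^sub>F p in sequentially.
      27 * h ^ 3 * real (nat (2 * J + 1) ^ 3) * (728 / 729) ^ p < v / 2"
    using v by (intro order_tendstoD) auto
  then obtain p where p: "27 * h ^ 3 * real (nat (2 * J + 1) ^ 3) * (728 / 729) ^ p < v / 2"
    by (auto simp: eventually_sequentially)
  \<comment> \<open>\<open>D\<close> may be huge, but \<open>p\<close> and \<open>J\<close> were
    chosen without \<open>k\<close>, so it is a constant for the asymptotics.\<close>
  define D where "D = (2::real) ^ card (index_cube (9 ^ p * J))"
  have bound: "outer_prob M (event_E d A N k) \<le> D * exp (- (C + 1) * real k)" if "k > 0" for k
  proof -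
    have "outer_prob M (event_E d A N k) \<le> D * (exp 1 * v) ^ k"
      unfolding D_def using p h J that assms by (intro outer_prob_event_E_le[where h = h]) auto
    also have "(exp 1 * v) ^ k = exp (- (C + 1) * real k)"
      by (simp add: v_def mult.commute flip: exp_add exp_of_nat_mult)
    finally show ?thesis .
  qed
  have "(\<lambda>k. outer_prob M (event_E d A N k)) \<in> O(\<lambda>k. exp (- (C + 1) * real k))"
    using bound
    by (intro bigoI[of _ D] eventually_mono[OF eventually_gt_at_top[of 0]])
      (simp add: abs_of_nonneg outer_prob_nonneg)
  also have "(\<lambda>k::nat. exp (- (C + 1) * real k)) \<in> o(\<lambda>k. exp (- C * real k))"
  proof (intro smalloI_tendsto)
    have "(\<lambda>k. exp (- 1) ^ k) \<longlonglongrightarrow> (0::real)" by (intro LIMSEQ_power_zero) simp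
    moreover have "exp (- (C + 1) * real k) / exp (- C * real k) = exp (- 1) ^ k" for k
      by (simp add: algebra_simps flip: exp_diff exp_of_nat_mult)
    ultimately show "(\<lambda>k. exp (- (C + 1) * real k) / exp (- C * real k)) \<longlonglongrightarrow> 0" by simp
  qed simp
  finally show ?thesis .
qed

end
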